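(* Let $\alpha<\beta$ be coprime positive integers, let $[I,J]$ with $I=(i_k)_{k=0}^n$, $J=(j_k)_{k=0}^n$ be an $(\alpha,\beta)$-fundamental couple, and let $\Delta$ be the $\langle\alpha,\beta\rangle$-semimodule generated by the elements of $I$. Then \[ \mathrm{Syz}(\Delta)=\bigcup_{0\le k<m\le n}\Big(\big(i_k+\langle\alpha,\beta\rangle\big)\cap\big(i_m+\langle\alpha,\beta\rangle\big)\Big)=\bigcup_{k=0}^{n}\big(j_k+\langle\alpha,\beta\rangle\big). \]
   Context: $\mathbb N$ contains $0$. $\Gamma=\langle\alpha,\beta\rangle=\{a\alpha+b\beta\mid a,b\in\mathbb N\}$ and $G=\mathbb N\setminus\Gamma$ is its set of gaps. A $\Gamma$-semimodule is a non-empty subset $\Delta\subseteq\mathbb N$ with $\Delta+\Gamma\subseteq\Delta$; the semimodule generated by a finite set $E\subseteq\mathbb N$ is $\bigcup_{x\in E}(x+\Gamma)$. An $(\alpha,\beta)$-fundamental couple $[I,J]$ consists of two integer sequences $I=(i_k)_{k=0}^n$ and $J=(j_k)_{k=0}^n$ such that: (0) $i_0=0$; (1) $i_1,\dots,i_n,j_1,\dots,j_{n-1}\in G$ and $j_0,j_n\le\alpha\beta$; (2) $i_k\equiv j_k \pmod\alpha$ and $i_k<j_k$ for $k=0,\dots,n$; $j_k\equiv i_{k+1}\pmod\beta$ and $j_k>i_{k+1}$ for $k=0,\dots,n-1$; $j_n\equiv i_0\pmod\beta$ and $j_n\ge i_0$; (3) $|i_k-i_m|\in G$ for $1\le k<m\le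 n$. A set $\{x_0=0,x_1,\dots,x_n\}\subseteq\mathbb N$ is $\Gamma$-lean if $|x_i-x_j|\notin\Gamma$ for $0\le i<j\le n$; the elements of $I$ in a fundamental couple form a $\Gamma$-lean set. If $\Delta$ is the $\Gamma$-semimodule generated by a $\Gamma$-lean set $E$, the syzygy of $\Delta$ is \[\mathrm{Syz}(\Delta):=\bigcup_{i,i'\in E,\ i\neq i'}\big((i+\Gamma)\cap(i'+\Gamma)\big).\]
   Formalization: The case n = 0 is excluded: there I = (0) and J = (αβ), so Syz(Δ) and the union over k < m are empty while αβ + ⟨α,β⟩ is not, and the printed equality fails; the result is proved for all n ≥ 1. *)

theory Defs
  imports Main "HOL-Number_Theory.Cong"
begin

text \<open>
  All subsets of the natural numbers are represented as sets of integers contained in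
  \<open>\<nat> :: int set\<close>, because the sequences of a fundamental couple are integer sequences and
  differences of their entries occur.
\<close>

definition Gam :: "nat \<Rightarrow> nat \<Rightarrow> int set" where
  "Gam \<alpha> \<beta> = {int a * int \<alpha> + int b * int \<beta> | a b :: nat. True}"

definition gaps :: "nat \<Rightarrow> nat \<Rightarrow> int set" where
  "gaps \<alpha> \<beta> = \<nat> - Gam \<alpha> \<beta>"

definition semimodule_gen :: "nat \<Rightarrow> nat \<Rightarrow> int set \<Rightarrow> int set" where
  "semimodule_gen \<alpha> \<beta> E = (\<Union>x\<in>E. (+) x ` Gam \<alpha> \<beta>)"

definition lean :: "nat \<Rightarrow> nat \<Rightarrow> int set \<Rightarrow> bool" where
  "lean \<alpha> \<beta> E \<longleftrightarrow> finite E \<and> E \<subseteq> \<nat> \<and> 0 \<in> E \<and>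
     (\<forall>x\<in>E. \<forall>y\<in>E. x \<noteq> y \<longrightarrow> \<bar>x - y\<bar> \<notin> Gam \<alpha> \<beta>)"

lemma lean_generators_unique:
  assumes "lean \<alpha> \<beta> E" "lean \<alpha> \<beta> E'" "semimodule_gen \<alpha> \<beta> E = semimodule_gen \<alpha> \<beta> E'"
  shows "E = E'"
proof -
  have zero: "0 \<in> Gam \<alpha> \<beta>"
    unfolding Gam_def by (auto intro!: exI[of _ "0::nat"])
  have nonneg: "0 \<le> g" if "g \<in> Gam \<alpha> \<beta>" for g
    using that unfolding Gam_def by auto
  have add: "g + h \<in> Gam \<alpha> \<beta>" if "g \<in> Gam \<alpha> \<beta>" "h \<in> Gam \<alpha> \<beta>" for g h
  proof -
    obtain a b where g: "g = int a * int \<alpha> + int b * int \<beta>"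
      using \<open>g \<in> Gam \<alpha> \<beta>\<close> unfolding Gam_def by blast
    obtain c d where h: "h = int c * int \<alpha> + int d * int \<beta>"
      using \<open>h \<in> Gam \<alpha> \<beta>\<close> unfolding Gam_def by blast
    have "g + h = int (a + c) * int \<alpha> + int (b + d) * int \<beta>"
      unfolding g h by (simp add: algebra_simps)
    then show ?thesis unfolding Gam_def by blast
  qed
  have sub: "A \<subseteq> B" if A: "lean \<alpha> \<beta> A"
    and eq: "semimodule_gen \<alpha> \<beta> A = semimodule_gen \<alpha> \<beta> B" for A B
  proof
    fix x assume x: "x \<in> A"
    then have "x \<in> semimodule_gen \<alpha> \<beta> A"
      using zero unfolding semimodule_gen_def by force
    then obtain y g where y: "y \<in> B" and g: "g \<in> Gam \<alpha> \<beta>" and xy: "x = y + g"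
      unfolding eq by (auto simp: semimodule_gen_def)
    have "y \<in> semimodule_gen \<alpha> \<beta> B"
      using y zero unfolding semimodule_gen_def by force
    then obtain z h where z: "z \<in> A" and h: "h \<in> Gam \<alpha> \<beta>" and yz: "y = z + h"
      unfolding eq[symmetric] by (auto simp: semimodule_gen_def)
    have "\<bar>x - z\<bar> = g + h"
      using xy yz nonneg[OF g] nonneg[OF h] by simp
    then have "\<bar>x - z\<bar> \<in> Gam \<alpha> \<beta>" using add[OF g h] by simp
    then have "x = z" using A x z unfolding lean_def by blast
    then have "g = 0" using xy yz nonneg[OF g] nonneg[OF h] by simp
    then show "x \<in> B" using xy y by simp
  qed
  show ?thesis
    by (rule equalityI[OF sub[OF assms(1,3)] sub[OF assms(2) assms(3)[symmetric]]])
qed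

text \<open>
  The syzygy depends only on the semimodule: by \<open>lean_generators_unique\<close> at most one lean
  set generates it. Nothing is asserted about \<open>Syz\<close> of a set not generated by a lean set.
\<close>

definition Syz :: "nat \<Rightarrow> nat \<Rightarrow> int set \<Rightarrow> int set" where
  "Syz \<alpha> \<beta> \<Delta> =
     (let E = (THE E. lean \<alpha> \<beta> E \<and> semimodule_gen \<alpha> \<beta> E = \<Delta>)
      in \<Union>{((+) i ` Gam \<alpha> \<beta>) \<inter> ((+) i' ` Gam \<alpha> \<beta>) | i i'. i \<in> E \<and> i' \<in> E \<and> i \<noteq> i'})"

text \<open>
  The sequences are \<open>I 0, \<dots>, I n\<close> and \<open>J 0, \<dots>, J n\<close>; values at indices above \<open>n\<close> are
  irrelevant. For \<open>n = 0\<close> and coprime \<open>\<alpha>\<close>, \<open>\<beta>\<close> the only couple is \<open>I = (0)\<close>, \<open>J = (\<alpha>\<beta>)\<close>; there the semimodule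
  has a single generator, so its syzygy is empty, although \<open>\<alpha>\<beta> + \<Gamma>\<close> is not.
\<close>

definition fundamental_couple ::
    "nat \<Rightarrow> nat \<Rightarrow> nat \<Rightarrow> (nat \<Rightarrow> int) \<Rightarrow> (nat \<Rightarrow> int) \<Rightarrow> bool" where
  "fundamental_couple \<alpha> \<beta> n I J \<longleftrightarrow>
     I 0 = 0 \<and>
     (\<forall>k\<in>{1..n}. I k \<in> gaps \<alpha> \<beta>) \<and>
     (\<forall>k\<in>{1..<n}. J k \<in> gaps \<alpha> \<beta>) \<and>
     J 0 \<le> int \<alpha> * int \<beta> \<and> J n \<le> int \<alpha> * int \<beta> \<and>
     (\<forall>k\<le>n. [I k = J k] (mod int \<alpha>) \<and> I k < J k) \<and>
     (\<forall>k<n. [J k = I (k + 1)] (mod int \<beta>) \<and> J k > I (k + 1)) \<and>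
     [J n = I 0] (mod int \<beta>) \<and> J n \<ge> I 0 \<and>
     (\<forall>k m. 1 \<le> k \<and> k < m \<and> m \<le> n \<longrightarrow> \<bar>I k - I m\<bar> \<in> gaps \<alpha> \<beta>)"

end

theory Submission
  imports Defs
begin

text \<open>
  Lift the integers to lattice points via \<open>(x, y) \<mapsto> \<alpha> x - \<beta> y\<close>, a map with kernel generated by
  \<open>(\<beta>, \<alpha>)\<close>; a translate of \<open>\<Gamma>\<close> lifts to the union of the \<open>(\<beta>, \<alpha>)\<close>-translates of a quadrant
  \<open>x \<ge> p, y \<le> q\<close>. The alternating sequence \<open>i\<^sub>0, j\<^sub>0, i\<^sub>1, j\<^sub>1, \<dots>\<close> lifts to a staircase with corners
  \<open>i\<^sub>k = (X\<^sub>k, Y\<^sub>k)\<close> and \<open>j\<^sub>k = (X\<^sub>k\<^sub>+\<^sub>1, Y\<^sub>k)\<close>, both coordinates being strictly increasing. The gap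
  conditions confine it to the box \<open>[0, \<beta>] \<times> [0, \<alpha>]\<close> and force \<open>X\<^sub>n\<^sub>+\<^sub>1 = \<beta>\<close>, so it closes up after
  exactly one period. Two quadrants of the periodic staircase meet inside the quadrant of the
  \<open>j\<close>-corner following the first of them.
\<close>

section \<open>Lattice coordinates for the translates of \<Gamma>\<close>

lemma mem_Gam_iff:
  "z \<in> Gam \<alpha> \<beta> \<longleftrightarrow> (\<exists>a b. 0 \<le> a \<and> 0 \<le> b \<and> z = a * int \<alpha> + b * int \<beta>)"
proof
  assume "z \<in> Gam \<alpha> \<beta>"
  then show "\<exists>a b. 0 \<le> a \<and> 0 \<le> b \<and> z = a * int \<alpha> + b * int \<beta>"
    unfolding Gam_def using of_nat_0_le_iff by blast
next
  assume "\<exists>a b. 0 \<le> a \<and> 0 \<le> b \<and> z = a * int \<alpha> + b * int \<beta>"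
  then show "z \<in> Gam \<alpha> \<beta>"
    unfolding Gam_def by (metis (mono_tags, lifting) mem_Collect_eq nonneg_int_cases)
qed

lemma translate_Gam_iff:
  "z \<in> (+) (int \<alpha> * p - int \<beta> * q) ` Gam \<alpha> \<beta> \<longleftrightarrow>
     (\<exists>x y. z = int \<alpha> * x - int \<beta> * y \<and> p \<le> x \<and> y \<le> q)"
proof
  assume "z \<in> (+) (int \<alpha> * p - int \<beta> * q) ` Gam \<alpha> \<beta>"
  then obtain a b where "0 \<le> a" "0 \<le> b"
    "z = int \<alpha> * p - int \<beta> * q + (a * int \<alpha> + b * int \<beta>)"
    by (auto simp: mem_Gam_iff)
  then show "\<exists>x y. z = int \<alpha> * x - int \<beta> * y \<and> p \<le> x \<and> y \<le> q"
    by (intro exI[of _ "p + a"] exI[of _ "q - b"]) (simp add: algebra_simps)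
next
  assume "\<exists>x y. z = int \<alpha> * x - int \<beta> * y \<and> p \<le> x \<and> y \<le> q"
  then obtain x y where "z = int \<alpha> * x - int \<beta> * y" "p \<le> x" "y \<le> q" by blast
  then have "z = (int \<alpha> * p - int \<beta> * q) + ((x - p) * int \<alpha> + (q - y) * int \<beta>)"
    by (simp add: algebra_simps)
  moreover have "(x - p) * int \<alpha> + (q - y) * int \<beta> \<in> Gam \<alpha> \<beta>"
    using \<open>p \<le> x\<close> \<open>y \<le> q\<close> unfolding mem_Gam_iff
    by (intro exI[of _ "x - p"] exI[of _ "q - y"]) simp
  ultimately show "z \<in> (+) (int \<alpha> * p - int \<beta> * q) ` Gam \<alpha> \<beta>" by blast
qed

lemma lattice_kernel:
  assumes "0 < \<beta>" "coprime \<alpha> \<beta>" and "int \<alpha> * x = int \<beta> * y"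
  obtains t where "x = t * int \<beta>" "y = t * int \<alpha>"
proof -
  have "int \<beta> dvd int \<alpha> * x" using assms(3) by simp
  moreover have "coprime (int \<beta>) (int \<alpha>)"
    using assms(2) by (simp add: coprime_commute)
  ultimately obtain t where t: "x = int \<beta> * t"
    by (auto simp: coprime_dvd_mult_right_iff)
  then have "int \<beta> * (int \<alpha> * t) = int \<beta> * y" using assms(3) by (simp add: algebra_simps)
  then have "y = int \<alpha> * t" using assms(1) by simp
  with t show ?thesis by (intro that[of t]) (simp_all add: mult.commute)
qed

section \<open>The closed staircase of a fundamental couple\<close>

definition staircase ::
  "nat \<Rightarrow> nat \<Rightarrow> nat \<Rightarrow> (nat \<Rightarrow> int) \<Rightarrow> (nat \<Rightarrow> int) \<Rightarrow> (nat \<Rightarrow> int) \<Rightarrow> (nat \<Rightarrow> int) \<Rightarrow> bool" where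
  "staircase \<alpha> \<beta> n I J X Y \<longleftrightarrow>
     (\<forall>k\<le>n. I k = int \<alpha> * X k - int \<beta> * Y k) \<and>
     (\<forall>k\<le>n. J k = int \<alpha> * X (Suc k) - int \<beta> * Y k) \<and>
     X 0 = 0 \<and> Y 0 = 0 \<and> X (Suc n) = int \<beta> \<and> Y (Suc n) = int \<alpha> \<and>
     (\<forall>k\<le>n. X k < X (Suc k) \<and> Y k < Y (Suc k))"

lemma staircase_mono:
  assumes "staircase \<alpha> \<beta> n I J X Y" and "k \<le> m" "m \<le> Suc n"
  shows "X k \<le> X m \<and> Y k \<le> Y m"
  using assms(2,3)
proof (induction m rule: dec_induct)
  case (step m)
  then have "X m < X (Suc m)" "Y m < Y (Suc m)"
    using assms(1) unfolding staircase_def by auto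
  with step show ?case by simp
qed simp

lemma fundamental_couple_staircase:
  assumes pos: "0 < \<alpha>" "0 < \<beta>" and cop: "coprime \<alpha> \<beta>"
    and fc: "fundamental_couple \<alpha> \<beta> n I J"
  obtains X Y where "staircase \<alpha> \<beta> n I J X Y"
proof -
  note F = fc[unfolded fundamental_couple_def]
  \<comment> \<open>Passing from \<open>I l\<close> to \<open>J l\<close> moves only the first
    coordinate, passing from \<open>J l\<close> to the next \<open>I\<close> only the second; both
    coordinates sum the quotients of these moves.\<close>
  define X where "X k = (\<Sum>l<k. (J l - I l) div int \<alpha>)" for k
  \<comment> \<open>After \<open>J n\<close> the sequence returns to \<open>I 0\<close>, which is 0;
    the value \<open>I (Suc n)\<close> is arbitrary and must not enter.\<close>
  define Y where "Y k = (\<Sum>l<k. (J l - (if l = n then 0 else I (Suc l))) div int \<beta>)" for k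
  have XS: "int \<alpha> * X (Suc k) = int \<alpha> * X k + (J k - I k)" if "k \<le> n" for k
  proof -
    have "int \<alpha> dvd J k - I k"
      using F that by (metis cong_iff_dvd_diff cong_sym)
    then show ?thesis by (simp add: X_def distrib_left)
  qed
  have YS: "int \<beta> * Y (Suc k) = int \<beta> * Y k + (J k - I (Suc k))" if "k < n" for k
  proof -
    have "int \<beta> dvd J k - I (Suc k)"
      using F that by (simp add: cong_iff_dvd_diff)
    then show ?thesis using that by (simp add: Y_def distrib_left)
  qed
  have YSn: "int \<beta> * Y (Suc n) = int \<beta> * Y n + J n"
  proof -
    have "int \<beta> dvd J n"
      using F by (auto simp: cong_iff_dvd_diff)
    then show ?thesis by (simp add: Y_def distrib_left)
  qed
  have I: "I k = int \<alpha> * X k - int \<beta> * Y k" if "k \<le> n" for k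
    using that
  proof (induction k)
    case 0
    then show ?case using F by (simp add: X_def Y_def)
  next
    case (Suc k)
    then show ?case using XS[of k] YS[of k] by simp
  qed
  have J: "J k = int \<alpha> * X (Suc k) - int \<beta> * Y k" if "k \<le> n" for k
    using I[OF that] XS[OF that] by simp
  have X_less: "X k < X (Suc k)" if "k \<le> n" for k
  proof -
    have "int \<alpha> * X k < int \<alpha> * X (Suc k)" using XS[OF that] F that by auto
    then show ?thesis using pos by simp
  qed
  have Y_less: "Y k < Y (Suc k)" if "k < n" for k
  proof -
    have "int \<beta> * Y k < int \<beta> * Y (Suc k)" using YS[OF that] F that by auto
    then show ?thesis using pos by simp
  qed
  \<comment> \<open>If \<open>x\<close> were at least \<beta>, subtracting the period (\<beta>,
    \<alpha>) would write the value with the nonnegative coefficients \<open>x - \<beta>\<close> and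
    \<open>\<alpha> - y\<close>.\<close>
  have gap: "x < int \<beta>" if "int \<alpha> * x - int \<beta> * y \<in> gaps \<alpha> \<beta>" "y \<le> int \<alpha>" for x y
  proof (rule ccontr)
    assume "\<not> x < int \<beta>"
    then have "int \<alpha> * x - int \<beta> * y \<in> Gam \<alpha> \<beta>"
      using that(2) unfolding mem_Gam_iff
      by (intro exI[of _ "x - int \<beta>"] exI[of _ "int \<alpha> - y"]) (simp add: algebra_simps)
    with that(1) show False by (simp add: gaps_def)
  qed
  \<comment> \<open>The bounds alternate: a gap \<open>J k\<close> bounds \<open>X (Suc k)\<close>,
    and then nonnegativity of \<open>I (Suc k)\<close> bounds \<open>Y (Suc k)\<close>.\<close>
  have box: "0 \<le> X k \<and> X k < int \<beta> \<and> 0 \<le> Y k \<and> Y k < int \<alpha>" if "k \<le> n" for k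
    using that
  proof (induction k)
    case 0
    then show ?case using pos by (simp add: X_def Y_def)
  next
    case (Suc k)
    have Ig: "I (Suc k) \<in> gaps \<alpha> \<beta>" using F Suc.prems by simp
    have "X (Suc k) < int \<beta>"
    proof (cases "k = 0")
      \<comment> \<open>\<open>J 0\<close> is only known to be at most \<alpha>\<beta>, which leaves
        \<open>X 1 = \<beta>\<close> possible; that case is excluded by the gap \<open>I 1\<close>
        once \<open>Y 1 \<le> \<alpha>\<close> is known.\<close>
      case True
      have "int \<alpha> * X 1 \<le> int \<alpha> * int \<beta>" using J[of 0] F by (simp add: Y_def)
      then have le: "X 1 \<le> int \<beta>" using pos by simp
      have Ig1: "int \<alpha> * X 1 - int \<beta> * Y 1 \<in> gaps \<alpha> \<beta>"
        using I[of 1] Ig Suc.prems True by simp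
      then have "0 \<le> int \<alpha> * X 1 - int \<beta> * Y 1" by (auto simp: gaps_def Nats_altdef2)
      with le have "int \<beta> * Y 1 \<le> int \<beta> * int \<alpha>"
        using mult_left_mono[OF le, of "int \<alpha>"] by (simp add: mult.commute)
      then have "Y 1 \<le> int \<alpha>" using pos by simp
      then show ?thesis using gap[OF Ig1] True by simp
    next
      case False
      then have "J k \<in> gaps \<alpha> \<beta>" using F Suc.prems by simp
      then show ?thesis using gap[of "X (Suc k)" "Y k"] J[of k] Suc by simp
    qed
    moreover have "Y (Suc k) < int \<alpha>"
    proof -
      have "0 \<le> int \<alpha> * X (Suc k) - int \<beta> * Y (Suc k)"
        using I[OF Suc.prems] Ig by (auto simp: gaps_def Nats_altdef2)
      moreover have "int \<alpha> * X (Suc k) < int \<alpha> * int \<beta>"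
        using \<open>X (Suc k) < int \<beta>\<close> pos by simp
      ultimately have "int \<beta> * Y (Suc k) < int \<beta> * int \<alpha>" by (simp add: mult.commute)
      then show ?thesis using pos by simp
    qed
    ultimately show ?case using X_less[of k] Y_less[of k] Suc by simp
  qed
  \<comment> \<open>The final corner represents \<open>I 0\<close>, hence 0, so it is a multiple
    \<open>t\<close> of the period. It remains to see that the staircase goes round exactly
    once.\<close>
  have "int \<alpha> * X (Suc n) = int \<beta> * Y (Suc n)"
    using J[of n] YSn by simp
  then obtain t where t: "X (Suc n) = t * int \<beta>" "Y (Suc n) = t * int \<alpha>"
    using lattice_kernel[OF pos(2) cop] by metis
  have "0 < t"
    using t(1) X_less[of n] box[of n] pos
    by (smt (verit) le_refl mult_nonneg_nonneg zero_less_mult_pos2 of_nat_0_less_iff)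
  moreover have "t < 2"
  proof -
    \<comment> \<open>The bound \<alpha>\<beta> on \<open>J n\<close> rules out a second
      period.\<close>
    have "int \<alpha> * X (Suc n) \<le> int \<alpha> * int \<beta> + int \<beta> * Y n" using J[of n] F by simp
    also have "\<dots> < int \<alpha> * int \<beta> + int \<beta> * int \<alpha>" using box[of n] pos by simp
    also have "\<dots> = int \<alpha> * (2 * int \<beta>)" by (simp add: algebra_simps)
    finally show ?thesis using pos t(1) by simp
  qed
  ultimately have "t = 1" by simp
  then have ends: "X (Suc n) = int \<beta>" "Y (Suc n) = int \<alpha>" using t by simp_all
  \<comment> \<open>At \<open>k = n\<close> strictness comes from the box, since
    \<open>Y (Suc n)\<close> is \<alpha>.\<close>
  have "Y k < Y (Suc k)" if "k \<le> n" for k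
    using that Y_less[of k] box[of n] ends(2) by (cases "k = n") auto
  moreover have "X 0 = 0" "Y 0 = 0" by (simp_all add: X_def Y_def)
  ultimately have "staircase \<alpha> \<beta> n I J X Y"
    unfolding staircase_def using I J X_less ends by blast
  with that show ?thesis .
qed

section \<open>Intersections of quadrants along the staircase\<close>

lemma staircase_intersections:
  assumes pos: "0 < \<beta>" and cop: "coprime \<alpha> \<beta>" and "1 \<le> n"
    and S: "staircase \<alpha> \<beta> n I J X Y"
  shows "\<Union>{((+) (I k) ` Gam \<alpha> \<beta>) \<inter> ((+) (I m) ` Gam \<alpha> \<beta>) | k m. 0 \<le> k \<and> k < m \<and> m \<le> n}
           = (\<Union>k\<in>{0..n}. (+) (J k) ` Gam \<alpha> \<beta>)" (is "?L = ?R")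
proof
  note mono = staircase_mono[OF S]
  have I: "z \<in> (+) (I k) ` Gam \<alpha> \<beta> \<longleftrightarrow>
      (\<exists>x y. z = int \<alpha> * x - int \<beta> * y \<and> X k \<le> x \<and> y \<le> Y k)" if "k \<le> n" for z k
    using S that by (simp add: staircase_def translate_Gam_iff)
  have J: "z \<in> (+) (J k) ` Gam \<alpha> \<beta> \<longleftrightarrow>
      (\<exists>x y. z = int \<alpha> * x - int \<beta> * y \<and> X (Suc k) \<le> x \<and> y \<le> Y k)" if "k \<le> n" for z k
    using S that by (simp add: staircase_def translate_Gam_iff)
  have X0: "X 0 = 0" "Y 0 = 0" and Xn: "X (Suc n) = int \<beta>" "Y (Suc n) = int \<alpha>"
    using S by (auto simp: staircase_def)
  show "?L \<subseteq> ?R"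
  proof
    fix z assume "z \<in> ?L"
    then obtain k m where km: "k < m" "m \<le> n"
      and z: "z \<in> (+) (I k) ` Gam \<alpha> \<beta>" "z \<in> (+) (I m) ` Gam \<alpha> \<beta>"
      by blast
    obtain x y where xy: "z = int \<alpha> * x - int \<beta> * y" "X k \<le> x" "y \<le> Y k"
      using z(1) I[of k] km by auto
    obtain x' y' where xy': "z = int \<alpha> * x' - int \<beta> * y'" "X m \<le> x'" "y' \<le> Y m"
      using z(2) I[of m] km by auto
    have "int \<alpha> * (x' - x) = int \<beta> * (y' - y)"
      using xy(1) xy'(1) by (simp add: algebra_simps)
    \<comment> \<open>The two lifts of \<open>z\<close> differ by \<open>t\<close> periods; the sign
      of \<open>t\<close> decides which one lies in the quadrant of a j-corner.\<close>
    then obtain t where t: "x' - x = t * int \<beta>"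
      using lattice_kernel[OF pos cop] by metis
    show "z \<in> ?R"
    proof (cases "t \<le> 0")
      \<comment> \<open>Here \<open>x\<close> also lies to the right of \<open>X m\<close>, so
        \<open>(x, y)\<close> is in the quadrant of \<open>J k\<close>.\<close>
      case True
      then have "x' \<le> x" using t mult_nonpos_nonneg[of t "int \<beta>"] by simp
      then have "X (Suc k) \<le> x" using mono[of "Suc k" m] km xy'(2) by simp
      then have "z \<in> (+) (J k) ` Gam \<alpha> \<beta>" using J[of k] km xy by auto
      then show ?thesis using km by auto
    next
      \<comment> \<open>Here \<open>x'\<close> is at least \<beta>, the largest abscissa of the
        staircase, so \<open>(x', y')\<close> is in the quadrant of \<open>J m\<close>.\<close>
      case False
      then have "int \<beta> \<le> t * int \<beta>" using pos by simp
      then have "int \<beta> \<le> x'" using t xy(2) mono[of 0 k] km X0 by simp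
      then have "X (Suc m) \<le> x'" using mono[of "Suc m" "Suc n"] km Xn by simp
      then have "z \<in> (+) (J m) ` Gam \<alpha> \<beta>" using J[of m] km xy' by auto
      then show ?thesis using km by auto
    qed
  qed
  show "?R \<subseteq> ?L"
  proof
    fix z assume "z \<in> ?R"
    then obtain k where k: "k \<le> n" and "z \<in> (+) (J k) ` Gam \<alpha> \<beta>" by auto
    then obtain x y where xy: "z = int \<alpha> * x - int \<beta> * y" "X (Suc k) \<le> x" "y \<le> Y k"
      using J by auto
    have zk: "z \<in> (+) (I k) ` Gam \<alpha> \<beta>"
      using I[OF k] xy mono[of k "Suc k"] k by (smt (verit) Suc_le_mono le_SucI le_refl)
    show "z \<in> ?L"
    proof (cases "k = n")
      case False
      have "y \<le> Y (Suc k)" using xy(3) mono[of k "Suc k"] k by simp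
      then have "z \<in> (+) (I (Suc k)) ` Gam \<alpha> \<beta>" using I[of "Suc k"] xy k False by auto
      then show ?thesis using zk k False by (blast intro: lessI Suc_leI le_neq_implies_less)
    next
      \<comment> \<open>The corner after \<open>J n\<close> is that of \<open>I 0\<close> moved by
        one period, so \<open>z\<close> is lifted one period lower. The pair of indices is then
        \<open>0\<close>, \<open>n\<close>, distinct because \<open>1 \<le> n\<close>.\<close>
      case True
      have "z = int \<alpha> * (x - int \<beta>) - int \<beta> * (y - int \<alpha>)"
        using xy(1) by (simp add: algebra_simps)
      moreover have "X 0 \<le> x - int \<beta>" "y - int \<alpha> \<le> Y 0"
        using xy True X0 Xn mono[of n "Suc n"] by simp_all
      ultimately have "z \<in> (+) (I 0) ` Gam \<alpha> \<beta>" using I[of 0] by blast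
      moreover have "0 < n" using \<open>1 \<le> n\<close> by simp
      ultimately show ?thesis using zk True by blast
    qed
  qed
qed

lemma fundamental_couple_diff:
  assumes "fundamental_couple \<alpha> \<beta> n I J" "k < m" "m \<le> n"
  shows "\<bar>I k - I m\<bar> \<in> gaps \<alpha> \<beta>"
proof (cases "k = 0")
  \<comment> \<open>The condition on differences starts at index 1; against \<open>I 0 = 0\<close>
    the difference is the gap \<open>I m\<close> itself.\<close>
  case True
  then have "I k = 0" "I m \<in> gaps \<alpha> \<beta>"
    using assms by (auto simp: fundamental_couple_def)
  then show ?thesis by (auto simp: gaps_def Nats_altdef2)
next
  case False
  then show ?thesis using assms by (auto simp: fundamental_couple_def)
qed

lemma fundamental_couple_lean:
  assumes fc: "fundamental_couple \<alpha> \<beta> n I J"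
  shows "lean \<alpha> \<beta> (I ` {0..n})"
proof -
  have I0: "I 0 = 0" and gap: "\<forall>k\<in>{1..n}. I k \<in> gaps \<alpha> \<beta>"
    using fc by (auto simp: fundamental_couple_def)
  have "I k \<in> \<nat>" if "k \<le> n" for k
    using I0 gap that by (cases "k = 0") (auto simp: gaps_def)
  moreover have "\<bar>I k - I m\<bar> \<notin> Gam \<alpha> \<beta>" if "k \<le> n" "m \<le> n" "I k \<noteq> I m" for k m
  proof (cases k m rule: linorder_cases)
    case less
    then show ?thesis using fundamental_couple_diff[OF fc less] that by (simp add: gaps_def)
  next
    case greater
    then show ?thesis using fundamental_couple_diff[OF fc greater] that
      by (simp add: gaps_def abs_minus_commute)
  qed (use that in simp)
  moreover have "0 \<in> I ` {0..n}" using I0 by force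
  ultimately show ?thesis by (auto simp: lean_def)
qed

text \<open>Since 0 lies in \<Gamma>, a difference that is a gap cannot vanish. This matches
  distinct indices with the distinct generators in \<open>Syz\<close>.\<close>

lemma fundamental_couple_inj:
  assumes fc: "fundamental_couple \<alpha> \<beta> n I J"
  shows "inj_on I {0..n}"
proof (rule linorder_inj_onI')
  fix k m assume "k \<in> {0..n}" "m \<in> {0..n}" "k < m"
  then have "\<bar>I k - I m\<bar> \<in> gaps \<alpha> \<beta>" using fundamental_couple_diff[OF fc] by simp
  moreover have "0 \<in> Gam \<alpha> \<beta>" unfolding mem_Gam_iff by (intro exI[of _ 0]) simp
  ultimately show "I k \<noteq> I m" by (auto simp: gaps_def)
qed

text \<open>Uniqueness of lean generators resolves the description operator in
  \<open>Syz\<close>.\<close>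

lemma Syz_lean:
  assumes "lean \<alpha> \<beta> E"
  shows "Syz \<alpha> \<beta> (semimodule_gen \<alpha> \<beta> E) =
    \<Union>{((+) i ` Gam \<alpha> \<beta>) \<inter> ((+) i' ` Gam \<alpha> \<beta>) | i i'. i \<in> E \<and> i' \<in> E \<and> i \<noteq> i'}"
proof -
  have "(THE E'. lean \<alpha> \<beta> E' \<and> semimodule_gen \<alpha> \<beta> E' = semimodule_gen \<alpha> \<beta> E) = E"
    by (rule the_equality) (use assms lean_generators_unique in blast)+
  then show ?thesis by (simp add: Syz_def)
qed

text \<open>Intersection is symmetric, so ordered pairs of distinct generators give the same union
  as index pairs \<open>k < m\<close>.\<close>

lemma Union_Int_image_pairs:
  fixes I :: "nat \<Rightarrow> 'a" and T :: "'a \<Rightarrow> 'b set"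
  assumes "inj_on I {0..n}"
  shows "\<Union>{T i \<inter> T i' | i i'. i \<in> I ` {0..n} \<and> i' \<in> I ` {0..n} \<and> i \<noteq> i'} =
    \<Union>{T (I k) \<inter> T (I m) | k m. 0 \<le> k \<and> k < m \<and> m \<le> n}" (is "?L = ?R")
proof
  show "?L \<subseteq> ?R"
  proof
    fix z assume "z \<in> ?L"
    then obtain k m where km: "k \<le> n" "m \<le> n" "I k \<noteq> I m" "z \<in> T (I k)" "z \<in> T (I m)"
      by auto
    then consider "k < m" | "m < k" by (metis linorder_neqE_nat)
    then show "z \<in> ?R" using km by cases blast+
  qed
  show "?R \<subseteq> ?L"
  proof
    fix z assume "z \<in> ?R"
    then obtain k m where km: "k < m" "m \<le> n" "z \<in> T (I k)" "z \<in> T (I m)" by blast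
    then have "I k \<noteq> I m" using inj_onD[OF assms, of k m] by auto
    moreover have "I k \<in> I ` {0..n}" "I m \<in> I ` {0..n}" using km by auto
    ultimately show "z \<in> ?L" using km by blast
  qed
qed

theorem theorem4p2:
  fixes \<alpha> \<beta> n :: nat and I J :: "nat \<Rightarrow> int" and \<Delta> :: "int set"
  assumes "0 < \<alpha>" and "\<alpha> < \<beta>" and "coprime \<alpha> \<beta>"
    and "1 \<le> n"
    and "fundamental_couple \<alpha> \<beta> n I J"
    and "\<Delta> = semimodule_gen \<alpha> \<beta> (I ` {0..n})"
  shows "Syz \<alpha> \<beta> \<Delta> =
           \<Union>{((+) (I k) ` Gam \<alpha> \<beta>) \<inter> ((+) (I m) ` Gam \<alpha> \<beta>) | k m. 0 \<le> k \<and> k < m \<and> m \<le> n}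
       \<and> \<Union>{((+) (I k) ` Gam \<alpha> \<beta>) \<inter> ((+) (I m) ` Gam \<alpha> \<beta>) | k m. 0 \<le> k \<and> k < m \<and> m \<le> n}
           = (\<Union>k\<in>{0..n}. (+) (J k) ` Gam \<alpha> \<beta>)"
proof
  show "Syz \<alpha> \<beta> \<Delta> =
      \<Union>{((+) (I k) ` Gam \<alpha> \<beta>) \<inter> ((+) (I m) ` Gam \<alpha> \<beta>) | k m. 0 \<le> k \<and> k < m \<and> m \<le> n}"
    unfolding assms(6) Syz_lean[OF fundamental_couple_lean[OF assms(5)]]
    by (rule Union_Int_image_pairs[OF fundamental_couple_inj[OF assms(5)],
          where T = "\<lambda>i. (+) i ` Gam \<alpha> \<beta>"])
  have "0 < \<beta>" using assms(2) by simp
  then obtain X Y where "staircase \<alpha> \<beta> n I J X Y"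
    using fundamental_couple_staircase assms by metis
  then show "\<Union>{((+) (I k) ` Gam \<alpha> \<beta>) \<inter> ((+) (I m) ` Gam \<alpha> \<beta>) | k m. 0 \<le> k \<and> k < m \<and> m \<le> n}
      = (\<Union>k\<in>{0..n}. (+) (J k) ` Gam \<alpha> \<beta>)"
    by (rule staircase_intersections[OF \<open>0 < \<beta>\<close> assms(3,4)])
qed

end
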